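(* Let $1\le p<\infty$, let $\{\beta(n)\}_{n\ge 0}$ and $\{\delta_n\}_{n\ge0}$ be sequences of positive numbers with $\beta(0)=1$ and $\delta_0=1$, let $m_1,m_2\in\mathbb{N}_0$, $u(z)=z^{m_1}$ and $\varphi(z)=z^{m_2}$. (a) Suppose $m_2\ge1$. Put $$\gamma=\sup_{n\in B_{m_1,m_2}}\frac{\delta_n\beta(n)}{\delta_{m_1}\delta_{n-m_1}\beta\left(\frac{n-m_1}{m_2}\right)},$$ where $B_{m_1,m_2}:=\{n: n\ge m_1\ \text{and}\ n-m_1\in M(m_2)\}$ and $M(m_2)=\{km_2: k\in\mathbb{N}_0\}$. If $\gamma<\infty$, then $u\diamond C_\varphi$ is a bounded operator on $\ell^p(\beta)$ and $\|u\diamond C_\varphi\|\le\gamma$. (b) If $u\diamond C_\varphi$ is a bounded operator on $\ell^p(\beta)$, then $$K:=\sup_{m\in\mathbb{N}_0}\frac{\delta_{m_1+mm_2}\,\beta(m_1+mm_2)}{\delta_{mm_2}\,\delta_{m_1}\,\beta(m)}<\infty,$$ with $K\le\|u\diamond C_\varphi\|$.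
   Context: $\mathbb{N}_0=\{0,1,2,\dots\}$. $\ell^{p}(\beta)$ is the space of formal power series $f(z)=\sum_{n\ge 0}\hat f(n)z^{n}$ with complex coefficients such that $\|f\|_\beta^p=\sum_{n\ge 0}|\hat f(n)|^p\beta(n)^p<\infty$, with norm $\|\cdot\|_\beta$. The weighted Cauchy product of formal power series is $(f\diamond g)(z)=\sum_{n\ge0}\sum_{k\ge0}\frac{\delta_{n+k}}{\delta_n\delta_k}\hat f(n)\hat g(k)z^{n+k}$. The $\diamond$-substitution operator is $(u\diamond C_\varphi)(f)=u\diamond(f\circ\varphi)$, where for $\varphi(z)=z^{m_2}$, $(f\circ\varphi)(z)=\sum_{n\ge0}\hat f(n)z^{nm_2}$ (for $m_2=0$ this is the constant $\sum_n\hat f(n)$, required to converge). It is bounded on $\ell^p(\beta)$ if it is defined on all of $\ell^p(\beta)$, maps it into itself and is bounded for $\|\cdot\|_\beta$; $\|u\diamond C_\varphi\|$ is the operator norm. Standing assumption: if $\lim_n\beta(n+1)/\beta(n)=1$ or $\liminf_n\beta(n)^{1/n}=1$, then $\varphi(\mathbb{D})\subseteq\mathbb{D}$, where $\mathbb{D}$ is the open unit disc of $\mathbb{C}$. *)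

theory Defs
  imports "HOL-Analysis.Analysis"
begin

definition weighted_lp :: "real \<Rightarrow> (nat \<Rightarrow> real) \<Rightarrow> complex fps set" where
  "weighted_lp p \<beta> = {f. summable (\<lambda>n. norm (fps_nth f n) powr p * \<beta> n powr p)}"

definition weighted_lp_norm :: "real \<Rightarrow> (nat \<Rightarrow> real) \<Rightarrow> complex fps \<Rightarrow> real" where
  "weighted_lp_norm p \<beta> f = (\<Sum>n. norm (fps_nth f n) powr p * \<beta> n powr p) powr (1 / p)"

text \<open>The double series over \<open>n\<close> and \<open>k\<close> with terms in \<open>z\<^sup>n\<^sup>+\<^sup>k\<close>, collected by total degree.\<close>

definition weighted_Cauchy :: "(nat \<Rightarrow> real) \<Rightarrow> complex fps \<Rightarrow> complex fps \<Rightarrow> complex fps" where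
  "weighted_Cauchy \<delta> f g = Abs_fps (\<lambda>N. \<Sum>i\<le>N.
     of_real (\<delta> N / (\<delta> i * \<delta> (N - i))) * fps_nth f i * fps_nth g (N - i))"

text \<open>The composition \<open>f \<circ> \<phi> = \<Sum>k. f\<^sub>k \<phi>\<^sup>k\<close>, taken coefficientwise. Unlike \<^const>\<open>fps_compose\<close>,
  this also makes sense when \<open>\<phi>\<close> has a nonzero constant term, provided that the coefficient
  series converge; the set \<open>fps_subst_dom \<phi>\<close> collects the \<open>f\<close> for which they do.\<close>

definition fps_subst_dom :: "complex fps \<Rightarrow> complex fps set" where
  "fps_subst_dom \<phi> = {f. \<forall>n. summable (\<lambda>k. fps_nth f k * fps_nth (\<phi> ^ k) n)}"

definition fps_subst :: "complex fps \<Rightarrow> complex fps \<Rightarrow> complex fps" where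
  "fps_subst f \<phi> = Abs_fps (\<lambda>n. \<Sum>k. fps_nth f k * fps_nth (\<phi> ^ k) n)"

text \<open>Meaningful only on \<open>fps_subst_dom \<phi>\<close>.\<close>

definition diamond_subst ::
    "(nat \<Rightarrow> real) \<Rightarrow> complex fps \<Rightarrow> complex fps \<Rightarrow> complex fps \<Rightarrow> complex fps" where
  "diamond_subst \<delta> u \<phi> f = weighted_Cauchy \<delta> u (fps_subst f \<phi>)"

definition diamond_subst_bounded ::
    "real \<Rightarrow> (nat \<Rightarrow> real) \<Rightarrow> (nat \<Rightarrow> real) \<Rightarrow> complex fps \<Rightarrow> complex fps \<Rightarrow> bool" where
  "diamond_subst_bounded p \<beta> \<delta> u \<phi> \<longleftrightarrow>
     weighted_lp p \<beta> \<subseteq> fps_subst_dom \<phi> \<and>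
     (\<forall>f\<in>weighted_lp p \<beta>. diamond_subst \<delta> u \<phi> f \<in> weighted_lp p \<beta>) \<and>
     (\<exists>C. \<forall>f\<in>weighted_lp p \<beta>.
        weighted_lp_norm p \<beta> (diamond_subst \<delta> u \<phi> f) \<le> C * weighted_lp_norm p \<beta> f)"

text \<open>Analogue of \<^const>\<open>onorm\<close>; the term for \<open>f = 0\<close> is \<open>0 / 0 = 0\<close>.
  The supremum is meaningful only for bounded operators.\<close>

definition diamond_subst_norm ::
    "real \<Rightarrow> (nat \<Rightarrow> real) \<Rightarrow> (nat \<Rightarrow> real) \<Rightarrow> complex fps \<Rightarrow> complex fps \<Rightarrow> real" where
  "diamond_subst_norm p \<beta> \<delta> u \<phi> =
     (SUP f\<in>weighted_lp p \<beta>.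
        weighted_lp_norm p \<beta> (diamond_subst \<delta> u \<phi> f) / weighted_lp_norm p \<beta> f)"

definition multiples :: "nat \<Rightarrow> nat set" where
  "multiples m = {k * m | k. True}"

definition B_set :: "nat \<Rightarrow> nat \<Rightarrow> nat set" where
  "B_set m1 m2 = {n. n \<ge> m1 \<and> n - m1 \<in> multiples m2}"

text \<open>For \<open>\<phi> = z\<^sup>m\<close> the composition is \<open>\<Sum>n. f\<^sub>n z\<^sup>n\<^sup>m\<close>; it always exists if \<open>m \<ge> 1\<close>, and it is the
  constant \<open>\<Sum>n. f\<^sub>n\<close> if \<open>m = 0\<close>.\<close>

lemma fps_X_power_sums:
  assumes "m \<ge> 1"
  shows "(\<lambda>k. fps_nth f k * fps_nth ((fps_X ^ m) ^ k) n) sums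
           (if m dvd n then fps_nth f (n div m) else (0::complex))"
proof (cases "m dvd n")
  case True
  have "(\<lambda>k. fps_nth f k * fps_nth ((fps_X ^ m) ^ k) n) =
        (\<lambda>k. if k = n div m then fps_nth f k else 0)"
    using True assms by (auto simp: fun_eq_iff fps_X_power_nth simp flip: power_mult)
  then show ?thesis using True sums_single[of "n div m" "fps_nth f"] by simp
next
  case False
  then have "(\<lambda>k. fps_nth f k * fps_nth ((fps_X ^ m) ^ k) n) = (\<lambda>k. 0)"
    by (auto simp: fun_eq_iff fps_X_power_nth simp flip: power_mult)
  then show ?thesis using False by simp
qed

lemma fps_subst_dom_X_power: "m \<ge> 1 \<Longrightarrow> fps_subst_dom (fps_X ^ m) = UNIV"
  using fps_X_power_sums by (auto simp: fps_subst_dom_def sums_iff)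

lemma fps_subst_X_power:
  "m \<ge> 1 \<Longrightarrow> fps_nth (fps_subst f (fps_X ^ m)) n = (if m dvd n then fps_nth f (n div m) else 0)"
  using fps_X_power_sums[of m f n] by (simp add: fps_subst_def sums_iff)

lemma fps_subst_dom_X_power_0: "f \<in> fps_subst_dom (fps_X ^ 0) \<longleftrightarrow> summable (fps_nth f)"
  by (auto simp: fps_subst_dom_def)

lemma fps_subst_X_power_0: "fps_subst f (fps_X ^ 0) = fps_const (\<Sum>n. fps_nth f n)"
  by (auto simp: fps_subst_def fps_eq_iff)

end

theory Submission
  imports Defs
begin

text \<open>For \<open>u = z\<^sup>a\<close> and \<open>\<phi> = z\<^sup>b\<close> the operator sends each monomial to a multiple of a monomial,
  \<open>z\<^sup>m \<mapsto> \<delta>(a + mb) / (\<delta>(a) \<delta>(mb)) z\<^sup>a\<^sup>+\<^sup>m\<^sup>b\<close>. Since \<open>z\<^sup>n\<close> has norm \<open>\<beta>(n)\<close>, it stretches \<open>z\<^sup>m\<close> by exactly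
  the factor over which the suprema \<open>\<gamma>\<close> and \<open>K\<close> are taken (put \<open>n = a + mb\<close>).

  The lower bound \<open>K\<close> is therefore obtained by testing on monomials
  (\<open>diamond_subst_monomial\<close>), which works for \<open>b = 0\<close> as well. For the upper bound \<open>\<gamma>\<close> take
  \<open>b \<ge> 1\<close>. Then \<open>m \<mapsto> a + mb\<close> is injective, so distinct monomials have images with disjoint supports
  and the operator is a weighted shift of coefficient sequences. Such a map increases
  the weighted \<open>\<ell>\<^sup>p\<close> norm at most by the supremum of its stretching factors
  (\<open>weighted_lp_reindex_bound\<close>).\<close>

lemma weighted_lp_norm_nonneg: "0 \<le> weighted_lp_norm p \<beta> f"
  by (simp add: weighted_lp_norm_def)

lemma weighted_monomial_sums:
  assumes "p > 0"
  shows "(\<lambda>n. norm (fps_nth (fps_const c * fps_X ^ k) n) powr p * \<beta> n powr p)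
           sums (norm c powr p * \<beta> k powr p)"
proof -
  have "(\<lambda>n. norm (fps_nth (fps_const c * fps_X ^ k) n) powr p * \<beta> n powr p)
          = (\<lambda>n. if n = k then norm c powr p * \<beta> n powr p else 0)"
    using assms by (auto simp: fun_eq_iff fps_X_power_nth)
  then show ?thesis
    using sums_single[of k "\<lambda>n. norm c powr p * \<beta> n powr p"] by simp
qed

lemma monomial_in_weighted_lp:
  "p > 0 \<Longrightarrow> fps_const c * fps_X ^ k \<in> weighted_lp p \<beta>"
  using weighted_monomial_sums[of p c k \<beta>] by (auto simp: weighted_lp_def sums_iff)

lemma weighted_lp_norm_monomial:
  assumes "p > 0" "0 \<le> \<beta> k"
  shows "weighted_lp_norm p \<beta> (fps_const c * fps_X ^ k) = norm c * \<beta> k"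
proof -
  have "weighted_lp_norm p \<beta> (fps_const c * fps_X ^ k)
          = (norm c powr p * \<beta> k powr p) powr (1 / p)"
    unfolding weighted_lp_norm_def
    using sums_unique[OF weighted_monomial_sums[OF assms(1), of c k \<beta>]] by simp
  also have "\<dots> = ((norm c * \<beta> k) powr p) powr (1 / p)"
    using assms by (simp add: powr_mult)
  also have "\<dots> = norm c * \<beta> k"
    using assms by (simp add: powr_powr)
  finally show ?thesis .
qed

text \<open>Moving the coefficients to distinct places \<open>s k\<close> only reorders the \<open>\<ell>\<^sup>p\<close> sum,
  up to zero terms, so a termwise bound gives a bound of the norms with the same constant.\<close>

lemma weighted_lp_reindex_bound:
  fixes s :: "nat \<Rightarrow> nat"
  assumes p: "p > 0" and c: "0 \<le> c" and \<beta>: "\<And>n. 0 \<le> \<beta> n"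
    and s: "strict_mono s"
    and off: "\<And>n. n \<notin> range s \<Longrightarrow> fps_nth g n = 0"
    and le: "\<And>k. norm (fps_nth g (s k)) * \<beta> (s k) \<le> c * (norm (fps_nth f k) * \<beta> k)"
    and f: "f \<in> weighted_lp p \<beta>"
  shows "g \<in> weighted_lp p \<beta>" "weighted_lp_norm p \<beta> g \<le> c * weighted_lp_norm p \<beta> f"
proof -
  define F where "F = (\<lambda>n. norm (fps_nth f n) powr p * \<beta> n powr p)"
  define G where "G = (\<lambda>n. norm (fps_nth g n) powr p * \<beta> n powr p)"
  have F: "summable F" using f by (simp add: weighted_lp_def F_def)
  have G_nonneg: "0 \<le> G n" for n by (simp add: G_def)
  have G_le: "G (s k) \<le> c powr p * F k" for k
  proof -
    have "G (s k) = (norm (fps_nth g (s k)) * \<beta> (s k)) powr p"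
      by (simp add: G_def powr_mult \<beta>)
    also have "\<dots> \<le> (c * (norm (fps_nth f k) * \<beta> k)) powr p"
      using p by (intro powr_mono2 le) (simp_all add: \<beta>)
    also have "\<dots> = c powr p * F k"
      by (simp add: F_def powr_mult \<beta> c)
    finally show ?thesis .
  qed
  have G_off: "G n = 0" if "n \<notin> range s" for n
    using off[OF that] p by (simp add: G_def)
  have cF: "summable (\<lambda>k. c powr p * F k)" using F by (rule summable_mult)
  have Gs: "summable (\<lambda>k. G (s k))"
    by (rule summable_comparison_test'[OF cF, of 0]) (simp add: G_le G_nonneg)
  then have G: "summable G" using summable_mono_reindex[of s G] s G_off by blast
  then show "g \<in> weighted_lp p \<beta>" by (simp add: weighted_lp_def G_def)
  have "suminf G = (\<Sum>k. G (s k))"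
    using suminf_mono_reindex[of s G] s G_off by simp
  also have "\<dots> \<le> (\<Sum>k. c powr p * F k)"
    by (rule suminf_le[OF G_le Gs cF])
  also have "\<dots> = c powr p * suminf F" by (rule suminf_mult[OF F])
  finally have "suminf G powr (1 / p) \<le> (c powr p * suminf F) powr (1 / p)"
    using p by (intro powr_mono2 suminf_nonneg G G_nonneg) auto
  also have "\<dots> = c * suminf F powr (1 / p)"
  proof -
    have "0 \<le> suminf F" by (rule suminf_nonneg[OF F]) (simp add: F_def)
    then show ?thesis using p c by (simp add: powr_mult powr_powr)
  qed
  finally show "weighted_lp_norm p \<beta> g \<le> c * weighted_lp_norm p \<beta> f"
    by (simp add: weighted_lp_norm_def F_def G_def)
qed

lemma weighted_Cauchy_X_power_nth:
  "fps_nth (weighted_Cauchy \<delta> (fps_X ^ a) g) n =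
     (if a \<le> n then of_real (\<delta> n / (\<delta> a * \<delta> (n - a))) * fps_nth g (n - a) else 0)"
proof -
  have "fps_nth (weighted_Cauchy \<delta> (fps_X ^ a) g) n =
          (\<Sum>i\<le>n. if i = a then of_real (\<delta> n / (\<delta> a * \<delta> (n - a))) * fps_nth g (n - a) else 0)"
    unfolding weighted_Cauchy_def fps_nth_Abs_fps
    by (rule sum.cong) (auto simp: fps_X_power_nth)
  then show ?thesis by simp
qed

lemma fps_subst_X_power_monomial: "fps_subst (fps_X ^ k) (fps_X ^ b) = fps_X ^ (k * b)"
proof (rule fps_ext)
  fix n
  \<comment> \<open>The coefficient series has only one nonzero term, also for \<open>b = 0\<close>.\<close>
  have "(\<lambda>j. fps_nth (fps_X ^ k :: complex fps) j * fps_nth ((fps_X ^ b) ^ j) n)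
          = (\<lambda>j. if j = k then fps_nth ((fps_X ^ b) ^ j) n else 0)"
    by (auto simp: fun_eq_iff fps_X_power_nth)
  then have "(\<lambda>j. fps_nth (fps_X ^ k :: complex fps) j * fps_nth ((fps_X ^ b) ^ j) n)
               sums fps_nth ((fps_X ^ b) ^ k) n"
    using sums_single[of k "\<lambda>j. fps_nth ((fps_X ^ b :: complex fps) ^ j) n"] by simp
  then show "fps_nth (fps_subst (fps_X ^ k) (fps_X ^ b)) n = fps_nth (fps_X ^ (k * b)) n"
    by (simp add: fps_subst_def sums_iff mult.commute flip: power_mult)
qed

lemma diamond_subst_monomial:
  "diamond_subst \<delta> (fps_X ^ a) (fps_X ^ b) (fps_X ^ k) =
     fps_const (of_real (\<delta> (a + k * b) / (\<delta> a * \<delta> (k * b)))) * fps_X ^ (a + k * b)"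
  by (rule fps_ext)
     (auto simp: diamond_subst_def fps_subst_X_power_monomial weighted_Cauchy_X_power_nth
        fps_X_power_nth)

lemma diamond_subst_nth:
  assumes "b \<ge> 1"
  shows "fps_nth (diamond_subst \<delta> (fps_X ^ a) (fps_X ^ b) f) (a + k * b) =
           of_real (\<delta> (a + k * b) / (\<delta> a * \<delta> (k * b))) * fps_nth f k"
    and "n \<notin> range (\<lambda>k. a + k * b) \<Longrightarrow>
           fps_nth (diamond_subst \<delta> (fps_X ^ a) (fps_X ^ b) f) n = 0"
proof -
  show "fps_nth (diamond_subst \<delta> (fps_X ^ a) (fps_X ^ b) f) (a + k * b) =
          of_real (\<delta> (a + k * b) / (\<delta> a * \<delta> (k * b))) * fps_nth f k"
    using assms
    by (simp add: diamond_subst_def weighted_Cauchy_X_power_nth fps_subst_X_power)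
next
  assume n: "n \<notin> range (\<lambda>k. a + k * b)"
  have "\<not> b dvd n - a" if "a \<le> n"
  proof
    assume "b dvd n - a"
    then obtain k where "n - a = k * b" by (metis dvd_def mult.commute)
    then have "n = a + k * b" using that by simp
    then show False using n by blast
  qed
  then show "fps_nth (diamond_subst \<delta> (fps_X ^ a) (fps_X ^ b) f) n = 0"
    using assms
    by (auto simp: diamond_subst_def weighted_Cauchy_X_power_nth fps_subst_X_power)
qed

lemma diamond_subst_norm_upper:
  assumes "diamond_subst_bounded p \<beta> \<delta> u \<phi>" "f \<in> weighted_lp p \<beta>"
  shows "weighted_lp_norm p \<beta> (diamond_subst \<delta> u \<phi> f) / weighted_lp_norm p \<beta> f
           \<le> diamond_subst_norm p \<beta> \<delta> u \<phi>"
proof -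
  obtain C where C: "\<And>f. f \<in> weighted_lp p \<beta> \<Longrightarrow>
      weighted_lp_norm p \<beta> (diamond_subst \<delta> u \<phi> f) \<le> C * weighted_lp_norm p \<beta> f"
    using assms(1) unfolding diamond_subst_bounded_def by blast
  \<comment> \<open>A quotient with zero denominator is \<open>0\<close>, which a negative \<open>C\<close> would not bound.\<close>
  have "weighted_lp_norm p \<beta> (diamond_subst \<delta> u \<phi> f) / weighted_lp_norm p \<beta> f \<le> max C 0"
    if "f \<in> weighted_lp p \<beta>" for f
  proof (cases "weighted_lp_norm p \<beta> f = 0")
    case False
    then have "0 < weighted_lp_norm p \<beta> f" using weighted_lp_norm_nonneg[of p \<beta> f] by simp
    then have "weighted_lp_norm p \<beta> (diamond_subst \<delta> u \<phi> f) / weighted_lp_norm p \<beta> f \<le> C"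
      using C[OF that] by (simp add: pos_divide_le_eq)
    then show ?thesis by simp
  qed simp
  then show ?thesis
    unfolding diamond_subst_norm_def by (intro cSUP_upper assms(2) bdd_aboveI2)
qed

lemma diamond_subst_norm_least:
  assumes "0 \<le> c"
    and le: "\<And>f. f \<in> weighted_lp p \<beta> \<Longrightarrow>
      weighted_lp_norm p \<beta> (diamond_subst \<delta> u \<phi> f) \<le> c * weighted_lp_norm p \<beta> f"
  shows "diamond_subst_norm p \<beta> \<delta> u \<phi> \<le> c"
  unfolding diamond_subst_norm_def
proof (rule cSUP_least)
  have "0 \<in> weighted_lp p \<beta>" by (simp add: weighted_lp_def)
  then show "weighted_lp p \<beta> \<noteq> {}" by blast
next
  fix f assume "f \<in> weighted_lp p \<beta>"
  then show "weighted_lp_norm p \<beta> (diamond_subst \<delta> u \<phi> f) / weighted_lp_norm p \<beta> f \<le> c"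
    using le[of f] weighted_lp_norm_nonneg[of p \<beta> f] assms(1)
    by (cases "weighted_lp_norm p \<beta> f = 0") (simp_all add: pos_divide_le_eq)
qed

lemma diamond_subst_monomials_bounded:
  assumes p: "p > 0" and \<beta>: "\<And>n. \<beta> n > 0" and \<delta>: "\<And>n. \<delta> n > 0" and b: "b \<ge> 1" and c: "0 \<le> c"
    and le: "\<And>k. \<delta> (a + k * b) * \<beta> (a + k * b) / (\<delta> a * \<delta> (k * b) * \<beta> k) \<le> c"
  shows "diamond_subst_bounded p \<beta> \<delta> (fps_X ^ a) (fps_X ^ b)"
    and "diamond_subst_norm p \<beta> \<delta> (fps_X ^ a) (fps_X ^ b) \<le> c"
proof -
  let ?T = "diamond_subst \<delta> (fps_X ^ a) (fps_X ^ b)"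
  have coeff_le: "norm (fps_nth (?T f) (a + k * b)) * \<beta> (a + k * b)
                    \<le> c * (norm (fps_nth f k) * \<beta> k)" for f k
  proof -
    have "norm (fps_nth (?T f) (a + k * b)) * \<beta> (a + k * b) =
        \<delta> (a + k * b) * \<beta> (a + k * b) / (\<delta> a * \<delta> (k * b) * \<beta> k) * (norm (fps_nth f k) * \<beta> k)"
      using \<beta>[of k] \<delta>[of a] \<delta>[of "k * b"] \<delta>[of "a + k * b"]
      by (simp add: diamond_subst_nth(1)[OF b] norm_mult norm_divide)
    also have "\<dots> \<le> c * (norm (fps_nth f k) * \<beta> k)"
      using \<beta>[of k] by (intro mult_right_mono le) simp
    finally show ?thesis .
  qed
  have mono: "strict_mono (\<lambda>k. a + k * b)" using b by (simp add: strict_mono_def)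
  note reindex = weighted_lp_reindex_bound[OF p c less_imp_le[OF \<beta>] mono
      diamond_subst_nth(2)[OF b] coeff_le]
  show "diamond_subst_bounded p \<beta> \<delta> (fps_X ^ a) (fps_X ^ b)"
    unfolding diamond_subst_bounded_def using reindex fps_subst_dom_X_power[OF b] by blast
  show "diamond_subst_norm p \<beta> \<delta> (fps_X ^ a) (fps_X ^ b) \<le> c"
    using reindex(2) by (rule diamond_subst_norm_least[OF c])
qed

lemma monomial_factor_le_diamond_subst_norm:
  assumes p: "p > 0" and \<beta>: "\<And>n. \<beta> n > 0" and \<delta>: "\<And>n. \<delta> n > 0"
    and bounded: "diamond_subst_bounded p \<beta> \<delta> (fps_X ^ a) (fps_X ^ b)"
  shows "\<delta> (a + k * b) * \<beta> (a + k * b) / (\<delta> (k * b) * \<delta> a * \<beta> k)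
           \<le> diamond_subst_norm p \<beta> \<delta> (fps_X ^ a) (fps_X ^ b)"
proof -
  have nonneg: "0 \<le> \<beta> n" for n using \<beta>[of n] by simp
  have "fps_X ^ k \<in> weighted_lp p \<beta>" "weighted_lp_norm p \<beta> (fps_X ^ k) = \<beta> k"
    using monomial_in_weighted_lp[OF p, of 1 k \<beta>]
      weighted_lp_norm_monomial[where c = 1, OF p nonneg] by simp_all
  moreover have "weighted_lp_norm p \<beta> (diamond_subst \<delta> (fps_X ^ a) (fps_X ^ b) (fps_X ^ k))
      = \<delta> (a + k * b) / (\<delta> a * \<delta> (k * b)) * \<beta> (a + k * b)"
    unfolding diamond_subst_monomial
    using weighted_lp_norm_monomial[OF p nonneg] \<delta>[of a] \<delta>[of "k * b"] \<delta>[of "a + k * b"]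
    by (simp add: norm_mult norm_divide)
  ultimately show ?thesis
    using diamond_subst_norm_upper[OF bounded, of "fps_X ^ k"] by (simp add: mult_ac)
qed

theorem corollary2p6:
  fixes p :: real and \<beta> \<delta> :: "nat \<Rightarrow> real" and m1 m2 :: nat and u \<phi> :: "complex fps"
  assumes "1 \<le> p"
    and "\<And>n. \<beta> n > 0" and "\<And>n. \<delta> n > 0"
    and "\<beta> 0 = 1" and "\<delta> 0 = 1"
    and "u = fps_X ^ m1" and "\<phi> = fps_X ^ m2"
    and standing: "(\<lambda>n. \<beta> (n + 1) / \<beta> n) \<longlonglongrightarrow> 1 \<or> liminf (\<lambda>n. ereal (root n (\<beta> n))) = 1
           \<Longrightarrow> eval_fps \<phi> ` ball 0 1 \<subseteq> ball 0 1"
  shows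
    "(m2 \<ge> 1 \<longrightarrow>
       (let \<gamma> = (SUP n\<in>B_set m1 m2.
                   ereal (\<delta> n * \<beta> n / (\<delta> m1 * \<delta> (n - m1) * \<beta> ((n - m1) div m2))))
        in \<gamma> < \<infinity> \<longrightarrow>
             diamond_subst_bounded p \<beta> \<delta> u \<phi> \<and> ereal (diamond_subst_norm p \<beta> \<delta> u \<phi>) \<le> \<gamma>)) \<and>
     (diamond_subst_bounded p \<beta> \<delta> u \<phi> \<longrightarrow>
       (let K = (SUP m. ereal (\<delta> (m1 + m * m2) * \<beta> (m1 + m * m2) / (\<delta> (m * m2) * \<delta> m1 * \<beta> m)))
        in K < \<infinity> \<and> K \<le> ereal (diamond_subst_norm p \<beta> \<delta> u \<phi>)))"
proof (intro conjI impI)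
  have p: "p > 0" using assms(1) by simp
  {
    assume b: "m2 \<ge> 1"
    let ?w = "\<lambda>n. \<delta> n * \<beta> n / (\<delta> m1 * \<delta> (n - m1) * \<beta> ((n - m1) div m2))"
    define \<gamma> where "\<gamma> = (SUP n\<in>B_set m1 m2. ereal (?w n))"
    have w_le: "ereal (\<delta> (m1 + k * m2) * \<beta> (m1 + k * m2) / (\<delta> m1 * \<delta> (k * m2) * \<beta> k)) \<le> \<gamma>" for k
    proof -
      have "m1 + k * m2 \<in> B_set m1 m2" by (auto simp: B_set_def multiples_def)
      then have "ereal (?w (m1 + k * m2)) \<le> \<gamma>" unfolding \<gamma>_def by (rule SUP_upper)
      then show ?thesis using b by simp
    qed
    have "diamond_subst_bounded p \<beta> \<delta> u \<phi> \<and> ereal (diamond_subst_norm p \<beta> \<delta> u \<phi>) \<le> \<gamma>"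
      if finite: "\<gamma> < \<infinity>"
    proof -
      have "0 \<le> \<delta> (m1 + 0 * m2) * \<beta> (m1 + 0 * m2) / (\<delta> m1 * \<delta> (0 * m2) * \<beta> 0)"
        using assms(2,3)[THEN less_imp_le] by simp
      then have "0 \<le> \<gamma>" using w_le[of 0] by (meson ereal_less_eq(5) order_trans)
      then obtain c where c: "\<gamma> = ereal c" "0 \<le> c" using finite by (cases \<gamma>) auto
      show ?thesis
        using diamond_subst_monomials_bounded[OF p assms(2,3) b c(2)] w_le
        unfolding assms(6,7) c(1) by simp
    qed
    then show "let \<gamma> = (SUP n\<in>B_set m1 m2. ereal (?w n))
        in \<gamma> < \<infinity> \<longrightarrow>
             diamond_subst_bounded p \<beta> \<delta> u \<phi> \<and> ereal (diamond_subst_norm p \<beta> \<delta> u \<phi>) \<le> \<gamma>"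
      by (simp add: Let_def \<gamma>_def)
  }
  {
    assume bounded: "diamond_subst_bounded p \<beta> \<delta> u \<phi>"
    let ?w = "\<lambda>m. \<delta> (m1 + m * m2) * \<beta> (m1 + m * m2) / (\<delta> (m * m2) * \<delta> m1 * \<beta> m)"
    have le: "(SUP m. ereal (?w m)) \<le> ereal (diamond_subst_norm p \<beta> \<delta> u \<phi>)"
      using monomial_factor_le_diamond_subst_norm[OF p assms(2,3)] bounded
      unfolding assms(6,7) by (intro SUP_least) simp
    then have "(SUP m. ereal (?w m)) < \<infinity>" by (rule order.strict_trans1) simp
    with le show "let K = (SUP m. ereal (?w m))
        in K < \<infinity> \<and> K \<le> ereal (diamond_subst_norm p \<beta> \<delta> u \<phi>)"
      by (simp add: Let_def)
  }
qed

end
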